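(* Let $\mathcal{F}_1$ and $\mathcal{F}_2$ be free linkages in the plane with length ranges $[l_{11},l_{12}]$ and $[l_{21},l_{22}]$ respectively. Let $\mathcal{F}_3$ be a free linkage consisting of two edges of lengths $a$ and $b$, where $|a-b|<\max\{l_{11},l_{21}\}$ and $a+b>\min\{l_{12},l_{22}\}$. Then $M(\mathcal{F}_1,\mathcal{F}_2,\mathcal{F}_3)$ equals (up to homeomorphism) the disjoint union of two copies of $M(\mathcal{F}_1,\mathcal{F}_2)$.
   Context: A free linkage $\mathcal{F}$ in $\mathbb{R}^2$ with length vector $(d_1,\ldots,d_n)$, $d_i>0$, has configurations $(x_1,\ldots,x_{n+1})\in(\mathbb{R}^2)^{n+1}$ with $|x_i-x_{i+1}|=d_i$ for $i=1,\ldots,n$; $x_1$ is the initial and $x_{n+1}$ the terminal vertex. For free linkages $\mathcal{F}_1,\ldots,\mathcal{F}_r$, $C(\mathcal{F}_1,\ldots,\mathcal{F}_r)$ is the space of $r$-tuples of configurations with all initial vertices at the origin and all terminal vertices coinciding, and $M(\mathcal{F}_1,\ldots,\mathcal{F}_r)=C(\mathcal{F}_1,\ldots,\mathcal{F}_r)/SO(2)$. The length range of a free linkage is the closed interval $[l_1,l_2]$, where $l_1$ is the minimum of $|x_{n+1}-x_1|$ over all its configurations and $l_2=\sum_{i=1}^n|x_{i+1}-x_i|=\sum_{i=1}^n d_i$. *)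

theory Defs
  imports "HOL-Analysis.Analysis"
begin

text \<open>
  A free linkage is given by its length vector. Vertices are indexed from 0, so the initial
  vertex is \<open>x 0\<close> and the terminal one is \<open>x (length ds)\<close>. Tuples of vertices are extensional
  functions, i.e. points of a library product topology.
\<close>

definition free_linkage :: "real list \<Rightarrow> bool" where
  "free_linkage ds \<longleftrightarrow> ds \<noteq> [] \<and> (\<forall>d\<in>set ds. 0 < d)"

definition configurations :: "real list \<Rightarrow> (nat \<Rightarrow> real^2) set" where
  "configurations ds =
     {x \<in> extensional {..length ds}. \<forall>i<length ds. norm (x i - x (Suc i)) = ds ! i}"

definition configuration_space :: "real list \<Rightarrow> (nat \<Rightarrow> real^2) topology" where
  "configuration_space ds =
     subtopology (product_topology (\<lambda>_. euclidean) {..length ds}) (configurations ds)"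

text \<open>\<open>has_length_range ds l1 l2\<close>: the length range is the interval \<open>{l1..l2}\<close>.\<close>

definition has_length_range :: "real list \<Rightarrow> real \<Rightarrow> real \<Rightarrow> bool" where
  "has_length_range ds l1 l2 \<longleftrightarrow>
     (\<exists>x\<in>configurations ds. norm (x (length ds) - x 0) = l1) \<and>
     (\<forall>x\<in>configurations ds. l1 \<le> norm (x (length ds) - x 0)) \<and>
     l2 = sum_list ds"

definition C_space :: "real list list \<Rightarrow> (nat \<Rightarrow> nat \<Rightarrow> real^2) topology" where
  "C_space Fs =
     subtopology (product_topology (\<lambda>j. configuration_space (Fs ! j)) {..<length Fs})
       {c. (\<forall>j<length Fs. c j 0 = 0) \<and>
           (\<forall>j<length Fs. \<forall>k<length Fs. c j (length (Fs ! j)) = c k (length (Fs ! k)))}"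

definition rotate_tuple ::
    "real list list \<Rightarrow> real^2^2 \<Rightarrow> (nat \<Rightarrow> nat \<Rightarrow> real^2) \<Rightarrow> nat \<Rightarrow> nat \<Rightarrow> real^2" where
  "rotate_tuple Fs A c = (\<lambda>j\<in>{..<length Fs}. \<lambda>i\<in>{..length (Fs ! j)}. A *v c j i)"

text \<open>\<open>rotation_matrix\<close> is membership in \<open>SO(2)\<close> here.\<close>

definition SO2_orbit ::
    "real list list \<Rightarrow> (nat \<Rightarrow> nat \<Rightarrow> real^2) \<Rightarrow> (nat \<Rightarrow> nat \<Rightarrow> real^2) set" where
  "SO2_orbit Fs c = {rotate_tuple Fs A c |A. rotation_matrix A}"

definition quotient_topology :: "'a topology \<Rightarrow> ('a \<Rightarrow> 'b) \<Rightarrow> 'b topology" where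
  "quotient_topology X q =
     topology (\<lambda>U. U \<subseteq> q ` topspace X \<and> openin X {x \<in> topspace X. q x \<in> U})"

definition M_space :: "real list list \<Rightarrow> (nat \<Rightarrow> nat \<Rightarrow> real^2) set topology" where
  "M_space Fs = quotient_topology (C_space Fs) (SO2_orbit Fs)"

lemma openin_quotient_topology:
  "openin (quotient_topology X q) U \<longleftrightarrow>
     U \<subseteq> q ` topspace X \<and> openin X {x \<in> topspace X. q x \<in> U}"
proof -
  have "istopology (\<lambda>U. U \<subseteq> q ` topspace X \<and> openin X {x \<in> topspace X. q x \<in> U})"
    unfolding istopology_def
  proof (intro conjI allI impI; (elim conjE)?)
    fix S T assume "openin X {x \<in> topspace X. q x \<in> S}" "openin X {x \<in> topspace X. q x \<in> T}"
    then have "openin X ({x \<in> topspace X. q x \<in> S} \<inter> {x \<in> topspace X. q x \<in> T})"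
      by (rule openin_Int)
    then show "openin X {x \<in> topspace X. q x \<in> S \<inter> T}"
      by (rule back_subst) auto
  next
    fix K assume K: "\<forall>U\<in>K. U \<subseteq> q ` topspace X \<and> openin X {x \<in> topspace X. q x \<in> U}"
    have "openin X (\<Union>U\<in>K. {x \<in> topspace X. q x \<in> U})"
      using K by blast
    then show "openin X {x \<in> topspace X. q x \<in> \<Union>K}"
      by (rule back_subst) auto
  qed auto
  then show ?thesis
    unfolding quotient_topology_def by (simp add: topology_inverse')
qed

lemma quotient_map_quotient_topology: "quotient_map X (quotient_topology X q) q"
proof -
  have "openin (quotient_topology X q) (q ` topspace X)"
  proof -
    have "{x \<in> topspace X. q x \<in> q ` topspace X} = topspace X" by auto
    then show ?thesis by (simp add: openin_quotient_topology)
  qed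
  then have "topspace (quotient_topology X q) = q ` topspace X"
    by (metis openin_quotient_topology openin_subset openin_topspace subset_antisym)
  then show ?thesis
    by (auto simp: quotient_map_def openin_quotient_topology)
qed

text \<open>The minimum in the length range exists.\<close>

lemma has_length_range_exists:
  assumes "free_linkage ds"
  shows "\<exists>l1. has_length_range ds l1 (sum_list ds)"
proof -
  define R :: "real list \<Rightarrow> (real^2) set" where
    "R = (\<lambda>ds. {x (length ds) - x 0 |x. \<forall>i<length ds. norm (x i - x (Suc i)) = ds ! i})"
  have R_Cons: "R (d # es) = {u + v |u v. u \<in> sphere 0 d \<and> v \<in> R es}" for d es
  proof (intro set_eqI iffI)
    fix w assume "w \<in> R (d # es)"
    then obtain x where x: "\<forall>i<length (d # es). norm (x i - x (Suc i)) = (d # es) ! i"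
      and w: "w = x (length (d # es)) - x 0"
      unfolding R_def by blast
    have "norm (x (Suc i) - x (Suc (Suc i))) = es ! i" if "i < length es" for i
      using x[rule_format, of "Suc i"] that by simp
    then have "x (Suc (length es)) - x (Suc 0) \<in> R es"
      unfolding R_def by (intro CollectI exI[of _ "x \<circ> Suc"]) auto
    moreover have "x (Suc 0) - x 0 \<in> sphere 0 d"
      using x[rule_format, of 0] by (simp add: norm_minus_commute)
    moreover have "w = (x (Suc 0) - x 0) + (x (Suc (length es)) - x (Suc 0))"
      using w by simp
    ultimately show "w \<in> {u + v |u v. u \<in> sphere 0 d \<and> v \<in> R es}" by blast
  next
    fix w assume "w \<in> {u + v |u v. u \<in> sphere 0 d \<and> v \<in> R es}"
    then obtain u x where u: "norm u = d"
      and x: "\<forall>i<length es. norm (x i - x (Suc i)) = es ! i"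
      and w: "w = u + (x (length es) - x 0)"
      unfolding R_def by auto
    define y where "y = case_nat (x 0 - u) x"
    have "norm (y i - y (Suc i)) = (d # es) ! i" if "i < length (d # es)" for i
      using that u x by (cases i) (auto simp: y_def)
    then show "w \<in> R (d # es)"
      unfolding R_def using w by (intro CollectI exI[of _ y]) (auto simp: y_def)
  qed
  have R: "compact (R es) \<and> R es \<noteq> {}" if "\<forall>d\<in>set es. 0 < d" for es
    using that
  proof (induction es)
    case Nil
    then show ?case by (simp add: R_def)
  next
    case (Cons d es)
    have es: "compact (R es)" "R es \<noteq> {}" using Cons by auto
    have "sphere (0::real^2) d \<noteq> {}" using Cons.prems by simp
    then have "R (d # es) \<noteq> {}" unfolding R_Cons using es(2) by blast
    moreover have "compact (R (d # es))"
      unfolding R_Cons by (rule compact_sums[OF compact_sphere es(1)])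
    ultimately show ?case by blast
  qed
  have "compact (norm ` R ds)" "norm ` R ds \<noteq> {}"
    using R[of ds] assms by (auto simp: free_linkage_def intro!: compact_continuous_image continuous_intros)
  then obtain l where l: "l \<in> norm ` R ds" "\<forall>t\<in>norm ` R ds. l \<le> t"
    using compact_attains_inf by metis
  obtain x :: "nat \<Rightarrow> real^2" where x: "\<forall>i<length ds. norm (x i - x (Suc i)) = ds ! i"
    "norm (x (length ds) - x 0) = l"
  proof -
    from l(1) obtain v where "v \<in> R ds" "l = norm v" by blast
    then show ?thesis using that unfolding R_def by blast
  qed
  have "restrict x {..length ds} \<in> configurations ds"
    using x(1) by (auto simp: configurations_def)
  moreover have "l \<le> norm (y (length ds) - y 0)" if "y \<in> configurations ds" for y
  proof -
    have "y (length ds) - y 0 \<in> R ds"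
      using that unfolding configurations_def R_def by blast
    then show ?thesis using l(2) by blast
  qed
  ultimately have "has_length_range ds l (sum_list ds)"
    unfolding has_length_range_def using x(2)
    by (intro conjI bexI[of _ "restrict x {..length ds}"]) auto
  then show ?thesis ..
qed

end

theory Submission
  imports Defs
begin

text \<open>
  Let \<open>p\<close> be the common terminal vertex of a tuple of configurations of the first two linkages.
  Its norm lies in both length ranges, so the hypotheses on \<open>a\<close> and \<open>b\<close> force
  \<open>\<bar>a - b\<bar> < norm p < a + b\<close>: the triangle with sides \<open>a\<close>, \<open>b\<close>, \<open>norm p\<close> exists and is never
  degenerate. A configuration of the two-edge linkage from \<open>0\<close> to \<open>p\<close> is determined by its middle
  vertex, the elbow, and there are exactly two choices, mirror images of each other in the line
  through \<open>0\<close> and \<open>p\<close>. Non-degeneracy gives three things: \<open>p \<noteq> 0\<close>, so each choice is a continuous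
  function of \<open>p\<close>; the elbow is never on the line, so the side on which it lies is locally
  constant; and the two choices are distinct. Hence adding an elbow on a chosen side is a
  homeomorphism from two disjoint copies of the space of pairs onto the space of triples
  (\<open>homeomorphic_map_attach\<close>).

  Rotations preserve the orientation of the plane, so they commute with the elbow construction and
  never interchange the two sides (\<open>elbow_rotation\<close>). Consequently two points of the disjoint union have the
  same image in the orbit space of triples iff they lie in the same copy and in the same orbit of
  pairs. The orbit space of triples and the disjoint union of two orbit spaces of pairs are thus
  quotients of one and the same space with the same fibres, and therefore homeomorphic. The argument
  works for any nonempty list of linkages in place of two (\<open>M_space_attach_two_bar\<close>).
\<close>

section \<open>Quotient maps and disjoint unions\<close>

text \<open>
  Each quotient map factors through the other one, and the two factorizations are mutually inverse.
\<close>

lemma quotient_maps_same_fibres_homeomorphic_space: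
  assumes f: "quotient_map X Y f" and g: "quotient_map X Z g"
    and fibres: "\<And>x x'. \<lbrakk>x \<in> topspace X; x' \<in> topspace X\<rbrakk> \<Longrightarrow> f x = f x' \<longleftrightarrow> g x = g x'"
  shows "Y homeomorphic_space Z"
proof -
  obtain h where h: "continuous_map Y Z h" "\<And>x. x \<in> topspace X \<Longrightarrow> h (f x) = g x"
    using quotient_map_lift_exists[OF f quotient_imp_continuous_map[OF g]] fibres by metis
  obtain k where k: "continuous_map Z Y k" "\<And>x. x \<in> topspace X \<Longrightarrow> k (g x) = f x"
    using quotient_map_lift_exists[OF g quotient_imp_continuous_map[OF f]] fibres by metis
  have "homeomorphic_maps Y Z h k"
    unfolding homeomorphic_maps_def
    using h k quotient_imp_surjective_map[OF f] quotient_imp_surjective_map[OF g]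
    by (metis imageE)
  then show ?thesis
    unfolding homeomorphic_space_def by blast
qed

text \<open>
  Openness in a disjoint union is tested on each summand separately, so it is enough that
  \<open>q\<close> detects open sets summand by summand.
\<close>

lemma quotient_map_sum_topology:
  assumes "quotient_map X Y q"
  shows "quotient_map (sum_topology (\<lambda>_. X) I) (sum_topology (\<lambda>_. Y) I) (\<lambda>(i, x). (i, q x))"
  unfolding quotient_map_def
proof (intro conjI allI impI)
  have q: "q ` topspace X = topspace Y"
    using assms by (simp add: quotient_map_def)
  then show "(\<lambda>(i, x). (i, q x)) ` topspace (sum_topology (\<lambda>_. X) I) = topspace (sum_topology (\<lambda>_. Y) I)"
    by (force simp: image_iff)
  fix V assume V: "V \<subseteq> topspace (sum_topology (\<lambda>_. Y) I)"
  let ?U = "{z \<in> topspace (sum_topology (\<lambda>_. X) I). (case z of (i, x) \<Rightarrow> (i, q x)) \<in> V}"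
  have "openin X {x. (i, x) \<in> ?U} \<longleftrightarrow> openin Y {y. (i, y) \<in> V}" if "i \<in> I" for i
  proof -
    have "{y. (i, y) \<in> V} \<subseteq> topspace Y" using V by auto
    moreover have "{x. (i, x) \<in> ?U} = {x \<in> topspace X. q x \<in> {y. (i, y) \<in> V}}"
      using that by auto
    moreover have "openin X {x \<in> topspace X. q x \<in> V'} \<longleftrightarrow> openin Y V'"
      if "V' \<subseteq> topspace Y" for V'
      using assms that by (simp add: quotient_map_def)
    ultimately show ?thesis by presburger
  qed
  moreover have "?U \<subseteq> Sigma I (topspace \<circ> (\<lambda>_. X))" by auto
  ultimately show "openin (sum_topology (\<lambda>_. X) I) ?U = openin (sum_topology (\<lambda>_. Y) I) V"
    using V unfolding openin_sum_topology by simp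
qed

section \<open>Triangles with two prescribed sides\<close>

definition quarter_turn :: "real^2 \<Rightarrow> real^2" where
  "quarter_turn p = vector [- (p $ 2), p $ 1]"

lemma quarter_turn_components [simp]:
  "quarter_turn p $ 1 = - (p $ 2)" "quarter_turn p $ 2 = p $ 1"
  by (simp_all add: quarter_turn_def)

lemma inner_real2: "x \<bullet> y = x $ 1 * y $ 1 + x $ 2 * y $ 2" for x y :: "real^2"
  by (simp add: inner_vec_def sum_2)

lemma inner_quarter_turn [simp]:
  "p \<bullet> quarter_turn p = 0" "quarter_turn p \<bullet> p = 0" "quarter_turn p \<bullet> quarter_turn p = p \<bullet> p"
  by (simp_all add: inner_real2)

text \<open>
  The vectors \<open>p\<close> and \<open>quarter_turn p\<close> are orthogonal and of equal length. The factor
  \<open>p \<bullet> p\<close> on the left avoids a division, so that \<open>p = 0\<close> is no exception.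
\<close>

lemma quarter_turn_basis:
  "(p \<bullet> p) *\<^sub>R y = (y \<bullet> p) *\<^sub>R p + (y \<bullet> quarter_turn p) *\<^sub>R quarter_turn p"
  by (simp add: vec_eq_iff forall_2 inner_real2 algebra_simps)

lemma inner_square_decomposition:
  "(y \<bullet> p)\<^sup>2 + (y \<bullet> quarter_turn p)\<^sup>2 = (y \<bullet> y) * (p \<bullet> p)"
  by (simp add: inner_real2 power2_eq_square algebra_simps)

text \<open>
  For positive \<open>a\<close> and \<open>b\<close>, the positions of \<open>p\<close> for which a triangle with vertices \<open>0\<close>, \<open>y\<close>, \<open>p\<close> and sides
  \<open>norm y = a\<close>, \<open>norm (y - p) = b\<close> exists and is not degenerate.
\<close>

definition annulus :: "real \<Rightarrow> real \<Rightarrow> (real^2) set" where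
  "annulus a b = {p. \<bar>a - b\<bar> < norm p \<and> norm p < a + b}"

text \<open>
  The apex \<open>y\<close> of that triangle has the form \<open>s *\<^sub>R p + t *\<^sub>R quarter_turn p\<close>. The law of cosines
  determines \<open>s\<close>, and \<open>norm y = a\<close> then determines \<open>t\<close> up to sign. The radicand in \<open>elbow_across\<close> is
  Heron's expression, 16 times the squared area of the triangle.
\<close>

definition elbow_along :: "real \<Rightarrow> real \<Rightarrow> real \<Rightarrow> real" where
  "elbow_along a b r = (r\<^sup>2 + a\<^sup>2 - b\<^sup>2) / (2 * r\<^sup>2)"

definition elbow_across :: "real \<Rightarrow> real \<Rightarrow> real \<Rightarrow> real" where
  "elbow_across a b r = sqrt (4 * a\<^sup>2 * r\<^sup>2 - (r\<^sup>2 + a\<^sup>2 - b\<^sup>2)\<^sup>2) / (2 * r\<^sup>2)"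

definition elbow :: "real \<Rightarrow> real \<Rightarrow> bool \<Rightarrow> real^2 \<Rightarrow> real^2" where
  "elbow a b e p = elbow_along a b (norm p) *\<^sub>R p +
     ((if e then 1 else - 1) * elbow_across a b (norm p)) *\<^sub>R quarter_turn p"

text \<open>
  Heron's factorization: one factor is the perimeter, and the other three are positive by the three
  strict triangle inequalities.
\<close>

lemma heron_pos:
  fixes a b r :: real
  assumes "\<bar>a - b\<bar> < r" "r < a + b"
  shows "0 < 4 * a\<^sup>2 * r\<^sup>2 - (r\<^sup>2 + a\<^sup>2 - b\<^sup>2)\<^sup>2"
proof -
  \<comment> \<open>The radicand is a difference of two squares, and each of its two factors is one again.\<close>
  have "0 < ((r + a + b) * (r + a - b)) * ((b - r + a) * (b + r - a))"
    using assms by (intro mult_pos_pos) auto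
  also have "\<dots> = 4 * a\<^sup>2 * r\<^sup>2 - (r\<^sup>2 + a\<^sup>2 - b\<^sup>2)\<^sup>2"
    by (simp add: power2_eq_square algebra_simps)
  finally show ?thesis .
qed

lemma elbow_across_pos:
  assumes "\<bar>a - b\<bar> < r" "r < a + b"
  shows "0 < elbow_across a b r"
  using heron_pos[OF assms] assms by (simp add: elbow_across_def)

text \<open>
  The two equations that say that the apex is at distance \<open>a\<close> from \<open>0\<close> and \<open>b\<close> from \<open>p\<close>, where
  \<open>r = norm p\<close>.
\<close>

lemma elbow_coefficients:
  assumes "\<bar>a - b\<bar> < r" "r < a + b"
  shows "elbow_along a b r * r\<^sup>2 = (r\<^sup>2 + a\<^sup>2 - b\<^sup>2) / 2"
    and "((elbow_along a b r)\<^sup>2 + (elbow_across a b r)\<^sup>2) * r\<^sup>2 = a\<^sup>2"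
proof -
  have r: "r > 0" using assms by auto
  then show "elbow_along a b r * r\<^sup>2 = (r\<^sup>2 + a\<^sup>2 - b\<^sup>2) / 2"
    by (simp add: elbow_along_def)
  have "(elbow_across a b r)\<^sup>2 = (4 * a\<^sup>2 * r\<^sup>2 - (r\<^sup>2 + a\<^sup>2 - b\<^sup>2)\<^sup>2) / (2 * r\<^sup>2)\<^sup>2"
    using heron_pos[OF assms] by (simp add: elbow_across_def power_divide)
  then have "(elbow_along a b r)\<^sup>2 + (elbow_across a b r)\<^sup>2 = 4 * a\<^sup>2 * r\<^sup>2 / (2 * r\<^sup>2)\<^sup>2"
    by (simp add: elbow_along_def power_divide flip: add_divide_distrib)
  then show "((elbow_along a b r)\<^sup>2 + (elbow_across a b r)\<^sup>2) * r\<^sup>2 = a\<^sup>2"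
    using r by (simp add: power2_eq_square field_simps)
qed

lemma norm_elbow:
  assumes "0 < a" "0 < b" "p \<in> annulus a b"
  shows "norm (elbow a b e p) = a" "norm (elbow a b e p - p) = b"
proof -
  define r s t where "r = norm p" and "s = elbow_along a b r"
    and "t = (if e then 1 else - 1) * elbow_across a b r"
  have r: "\<bar>a - b\<bar> < r" "r < a + b" using assms by (auto simp: annulus_def r_def)
  have y: "elbow a b e p = s *\<^sub>R p + t *\<^sub>R quarter_turn p"
    by (simp add: elbow_def r_def s_def t_def)
  have pp: "p \<bullet> p = r\<^sup>2" by (simp add: r_def power2_norm_eq_inner)
  have s: "s * r\<^sup>2 = (r\<^sup>2 + a\<^sup>2 - b\<^sup>2) / 2" and st: "(s\<^sup>2 + t\<^sup>2) * r\<^sup>2 = a\<^sup>2"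
    using elbow_coefficients[OF r] by (simp_all add: s_def t_def power_mult_distrib)
  have "(norm (elbow a b e p))\<^sup>2 = (s\<^sup>2 + t\<^sup>2) * r\<^sup>2"
    unfolding power2_norm_eq_inner y
    by (simp add: inner_add_left inner_add_right pp power2_eq_square algebra_simps)
  also note st
  finally have na: "(norm (elbow a b e p))\<^sup>2 = a\<^sup>2" .
  then show "norm (elbow a b e p) = a"
    using assms(1) by (simp add: power2_eq_iff_nonneg)
  have "elbow a b e p \<bullet> p = s * r\<^sup>2"
    by (simp add: y inner_add_left pp)
  then have "(norm (elbow a b e p - p))\<^sup>2 = b\<^sup>2"
    using na s pp by (simp add: power2_norm_eq_inner inner_diff_left inner_diff_right inner_commute[of p "elbow a b e p"])
  then show "norm (elbow a b e p - p) = b"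
    using assms(2) by (simp add: power2_eq_iff_nonneg)
qed

text \<open>
  The number \<open>y \<bullet> quarter_turn p\<close> is the signed area of the parallelogram spanned by \<open>p\<close> and \<open>y\<close>;
  its sign tells the two elbows apart, and it does not vanish because the triangle is not degenerate.
\<close>

lemma elbow_side:
  assumes "p \<in> annulus a b"
  shows "0 < elbow a b e p \<bullet> quarter_turn p \<longleftrightarrow> e"
    and "elbow a b e p \<bullet> quarter_turn p \<noteq> 0"
proof -
  have r: "\<bar>a - b\<bar> < norm p" "norm p < a + b" using assms by (auto simp: annulus_def)
  then have "0 < elbow_across a b (norm p) * (p \<bullet> p)"
    using elbow_across_pos[OF r] by (intro mult_pos_pos) auto
  moreover have "elbow a b e p \<bullet> quarter_turn p =
      (if e then 1 else - 1) * (elbow_across a b (norm p) * (p \<bullet> p))"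
    by (simp add: elbow_def inner_add_left)
  ultimately show "0 < elbow a b e p \<bullet> quarter_turn p \<longleftrightarrow> e"
    "elbow a b e p \<bullet> quarter_turn p \<noteq> 0" by auto
qed

text \<open>
  The given distances fix the inner product of \<open>y\<close> with \<open>p\<close> and the square of that with
  \<open>quarter_turn p\<close>, which leaves only a sign undetermined.
\<close>

lemma elbow_unique:
  assumes "p \<in> annulus a b" and a: "norm y = a" and b: "norm (y - p) = b"
  shows "y = elbow a b (0 < y \<bullet> quarter_turn p) p"
proof -
  define r where "r = norm p"
  define T where "T = (y \<bullet> quarter_turn p) / r\<^sup>2"
  have r: "\<bar>a - b\<bar> < r" "r < a + b" using assms by (auto simp: annulus_def r_def)
  then have r0: "r > 0" by linarith
  have pp: "p \<bullet> p = r\<^sup>2" and yy: "y \<bullet> y = a\<^sup>2"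
    by (simp_all add: r_def flip: a power2_norm_eq_inner)
  have "b\<^sup>2 = a\<^sup>2 - 2 * (y \<bullet> p) + r\<^sup>2"
    unfolding b[symmetric] power2_norm_eq_inner
    by (simp add: inner_diff_left inner_diff_right inner_commute[of p y] pp yy)
  then have along: "y \<bullet> p = elbow_along a b r * r\<^sup>2"
    using elbow_coefficients(1)[OF r] by simp
  have across: "y \<bullet> quarter_turn p = T * r\<^sup>2"
    using r0 by (simp add: T_def)
  have "((elbow_along a b r)\<^sup>2 + T\<^sup>2) * r\<^sup>2 * r\<^sup>2 = a\<^sup>2 * r\<^sup>2"
    using inner_square_decomposition[of y p] unfolding along across yy pp
    by (simp add: power2_eq_square algebra_simps)
  then have "T\<^sup>2 = (elbow_across a b r)\<^sup>2"
    using r0 unfolding elbow_coefficients(2)[OF r, symmetric] by simp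
  then have "\<bar>T\<bar> = elbow_across a b r"
    using elbow_across_pos[OF r] by (metis abs_of_pos power2_eq_iff abs_minus)
  moreover have "0 < y \<bullet> quarter_turn p \<longleftrightarrow> 0 < T"
    using r0 by (simp add: T_def zero_less_divide_iff)
  ultimately have T: "T = (if 0 < y \<bullet> quarter_turn p then 1 else - 1) * elbow_across a b r"
    by auto
  have "r\<^sup>2 *\<^sub>R y = r\<^sup>2 *\<^sub>R (elbow_along a b r *\<^sub>R p + T *\<^sub>R quarter_turn p)"
    using quarter_turn_basis[of p y] unfolding along across pp
    by (simp add: algebra_simps)
  then have "y = elbow_along a b r *\<^sub>R p + T *\<^sub>R quarter_turn p"
    using r0 by simp
  then show ?thesis unfolding elbow_def T r_def .
qed

lemma continuous_on_quarter_turn: "continuous_on S quarter_turn"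
proof -
  have "linear quarter_turn"
    by (rule linearI) (simp_all add: vec_eq_iff forall_2)
  then show ?thesis
    by (simp add: linear_continuous_on linear_conv_bounded_linear)
qed

lemma continuous_on_elbow: "continuous_on (annulus a b) (elbow a b e)"
  unfolding elbow_def elbow_along_def elbow_across_def
  by (intro continuous_intros continuous_on_quarter_turn) (auto simp: annulus_def)

text \<open>
  In complex notation both maps are multiplications by a number, hence commute. Concretely, orthogonality and
  determinant 1 make a sum of two squares vanish, which gives \<open>A\<close> the shape of a rotation by an angle.
  A reflection would change the sign, and here the restriction to orientation-preserving isometries
  enters.
\<close>

lemma quarter_turn_rotation:
  fixes A :: "real^2^2"
  assumes "rotation_matrix A"
  shows "quarter_turn (A *v p) = A *v quarter_turn p"
proof -
  have "transpose A ** A = mat 1" and "A $ 1 $ 1 * A $ 2 $ 2 - A $ 1 $ 2 * A $ 2 $ 1 = 1"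
    using assms by (auto simp: rotation_matrix_def orthogonal_matrix_def det_2)
  moreover from this(1) have "(A $ 1 $ 1)\<^sup>2 + (A $ 2 $ 1)\<^sup>2 = 1" "(A $ 1 $ 2)\<^sup>2 + (A $ 2 $ 2)\<^sup>2 = 1"
    by (simp_all add: vec_eq_iff forall_2 matrix_matrix_mult_def transpose_def mat_def sum_2 power2_eq_square)
  ultimately have "(A $ 1 $ 1 - A $ 2 $ 2)\<^sup>2 + (A $ 1 $ 2 + A $ 2 $ 1)\<^sup>2 = 0"
    by (simp add: power2_eq_square algebra_simps)
  then have "A $ 2 $ 2 = A $ 1 $ 1" "A $ 2 $ 1 = - (A $ 1 $ 2)"
    by (auto simp: sum_power2_eq_zero_iff)
  then show ?thesis
    by (simp add: vec_eq_iff forall_2 matrix_vector_mult_def sum_2)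
qed

lemma norm_rotation:
  fixes A :: "real^'n^'n"
  assumes "rotation_matrix A"
  shows "norm (A *v p) = norm p"
proof -
  have "orthogonal_transformation ((*v) A)"
    using assms by (simp add: rotation_matrix_def orthogonal_transformation_matrix)
  then show ?thesis
    by (simp add: orthogonal_transformation_norm)
qed

lemma elbow_rotation:
  assumes "rotation_matrix A"
  shows "elbow a b e (A *v p) = A *v elbow a b e p"
  using assms
  by (simp add: elbow_def norm_rotation quarter_turn_rotation matrix_vector_right_distrib
      matrix_vector_mult_scaleR)

section \<open>Tuples of configurations and their rotations\<close>

text \<open>
  On the space of tuples all terminal vertices coincide, so the one of the first linkage serves as
  the common terminal vertex. For an empty list of linkages the value has no meaning.
\<close>

definition endpoint :: "real list list \<Rightarrow> (nat \<Rightarrow> nat \<Rightarrow> real^2) \<Rightarrow> real^2" where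
  "endpoint Fs c = c 0 (length (Fs ! 0))"

lemma topspace_configuration_space: "topspace (configuration_space ds) = configurations ds"
  by (auto simp: configuration_space_def configurations_def PiE_def)

lemma topspace_C_space:
  "c \<in> topspace (C_space Fs) \<longleftrightarrow> c \<in> extensional {..<length Fs} \<and>
     (\<forall>j<length Fs. c j \<in> configurations (Fs ! j) \<and> c j 0 = 0 \<and>
        c j (length (Fs ! j)) = endpoint Fs c)"
proof -
  have "(\<forall>j<length Fs. \<forall>k<length Fs. c j (length (Fs ! j)) = c k (length (Fs ! k))) \<longleftrightarrow>
        (\<forall>j<length Fs. c j (length (Fs ! j)) = endpoint Fs c)" (is "?coincide \<longleftrightarrow> ?ends")
  proof
    assume ?coincide
    then show ?ends
      unfolding endpoint_def using le_less_trans[OF le0] by blast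
  next
    assume ?ends
    then show ?coincide by metis
  qed
  moreover have "c \<in> topspace (C_space Fs) \<longleftrightarrow>
      c \<in> (\<Pi>\<^sub>E j\<in>{..<length Fs}. configurations (Fs ! j)) \<and> (\<forall>j<length Fs. c j 0 = 0) \<and> ?coincide"
    unfolding C_space_def topspace_subtopology topspace_product_topology
    by (simp only: o_def topspace_configuration_space Int_iff mem_Collect_eq)
  ultimately show ?thesis
    by (simp only: PiE_iff) auto
qed

text \<open>
  Adding a linkage at the end of a list amounts to adding one configuration that starts at the
  origin and ends at the common terminal vertex of the others.
\<close>

lemma topspace_C_space_snoc:
  assumes "Fs \<noteq> []"
  shows "d \<in> topspace (C_space (Fs @ [ds])) \<longleftrightarrow>
    d \<in> extensional {..length Fs} \<and> restrict d {..<length Fs} \<in> topspace (C_space Fs) \<and>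
    d (length Fs) \<in> configurations ds \<and> d (length Fs) 0 = 0 \<and>
    d (length Fs) (length ds) = endpoint Fs d"
proof -
  have "endpoint (Fs @ [ds]) d = endpoint Fs d"
    "endpoint Fs (restrict d {..<length Fs}) = endpoint Fs d"
    using assms by (simp_all add: endpoint_def nth_append)
  then show ?thesis
    by (auto simp: topspace_C_space less_Suc_eq nth_append lessThan_Suc_atMost)
qed

lemma continuous_map_vertex:
  assumes "j < length Fs" "i \<le> length (Fs ! j)"
  shows "continuous_map (C_space Fs) euclidean (\<lambda>c. c j i)"
proof -
  have vertex: "continuous_map (configuration_space (Fs ! j)) euclidean (\<lambda>x. x i)"
    unfolding configuration_space_def
    using assms by (intro continuous_map_from_subtopology continuous_map_product_projection) auto
  have "continuous_map (C_space Fs) (configuration_space (Fs ! j)) (\<lambda>c. c j)"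
    unfolding C_space_def
    using assms by (intro continuous_map_from_subtopology continuous_map_product_projection) auto
  from continuous_map_compose[OF this vertex] show ?thesis
    by (simp add: o_def)
qed

text \<open>
  The space of tuples carries the topology of an iterated product of planes, so continuity is
  tested vertex by vertex.
\<close>

lemma continuous_map_into_C_space:
  assumes f: "\<And>x. x \<in> topspace X \<Longrightarrow> f x \<in> topspace (C_space Fs)"
    and vertex: "\<And>j i. \<lbrakk>j < length Fs; i \<le> length (Fs ! j)\<rbrakk> \<Longrightarrow> continuous_map X euclidean (\<lambda>x. f x j i)"
  shows "continuous_map X (C_space Fs) f"
proof -
  have "continuous_map X (configuration_space (Fs ! j)) (\<lambda>x. f x j)" if j: "j < length Fs" for j
  proof -
    have conf: "f x j \<in> configurations (Fs ! j)" if "x \<in> topspace X" for x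
      using f[OF that] j by (simp add: topspace_C_space)
    then have "(\<lambda>x. f x j) ` topspace X \<subseteq> extensional {..length (Fs ! j)}"
      by (auto simp: configurations_def)
    then show ?thesis
      unfolding configuration_space_def continuous_map_in_subtopology continuous_map_componentwise
      using conf vertex j by auto
  qed
  moreover have "f ` topspace X \<subseteq> extensional {..<length Fs}"
    using f by (auto simp: topspace_C_space)
  ultimately show ?thesis
    using f unfolding C_space_def continuous_map_in_subtopology continuous_map_componentwise topspace_subtopology
    by (blast intro: Pi_I)
qed

lemma rotate_tuple_compose:
  "rotate_tuple Fs B (rotate_tuple Fs A c) = rotate_tuple Fs (B ** A) c"
  by (auto simp: rotate_tuple_def fun_eq_iff matrix_vector_mul_assoc)

lemma rotate_tuple_mat_1:
  assumes "c \<in> topspace (C_space Fs)"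
  shows "rotate_tuple Fs (mat 1) c = c"
proof (intro ext)
  fix j i
  have "c \<in> extensional {..<length Fs}"
    and "j < length Fs \<Longrightarrow> c j \<in> extensional {..length (Fs ! j)}"
    using assms by (simp_all add: topspace_C_space configurations_def)
  then show "rotate_tuple Fs (mat 1) c j i = c j i"
    by (auto simp: rotate_tuple_def extensional_def restrict_def)
qed

lemma rotation_matrix_group:
  fixes A B :: "real^'n^'n"
  shows "rotation_matrix (mat 1 :: real^'n^'n)"
    and "\<lbrakk>rotation_matrix A; rotation_matrix B\<rbrakk> \<Longrightarrow> rotation_matrix (A ** B)"
    and "rotation_matrix A \<Longrightarrow> rotation_matrix (transpose A)"
    and "rotation_matrix A \<Longrightarrow> transpose A ** A = mat 1"
proof -
  show "rotation_matrix (mat 1 :: real^'n^'n)"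
    by (simp add: rotation_matrix_def orthogonal_matrix_id)
  show "rotation_matrix (A ** B)" if "rotation_matrix A" "rotation_matrix B"
    using that by (simp add: rotation_matrix_def orthogonal_matrix_mul det_mul)
  show "rotation_matrix (transpose A)" if "rotation_matrix A"
    using that by (simp add: rotation_matrix_def)
  show "transpose A ** A = mat 1" if "rotation_matrix A"
    using that by (simp add: rotation_matrix_def orthogonal_matrix_def)
qed

text \<open>
  The matrices act as a group on tuples of configurations, so orbits are either equal or disjoint.
  Membership in the space of tuples guarantees that the identity matrix acts trivially: it makes
  the tuple extensional, as is every rotated tuple.
\<close>

lemma SO2_orbit_eq_iff:
  assumes c: "c \<in> topspace (C_space Fs)" and c': "c' \<in> topspace (C_space Fs)"
  shows "SO2_orbit Fs c = SO2_orbit Fs c' \<longleftrightarrow> (\<exists>A. rotation_matrix A \<and> c' = rotate_tuple Fs A c)"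
proof
  assume "SO2_orbit Fs c = SO2_orbit Fs c'"
  moreover have "c' \<in> SO2_orbit Fs c'"
    unfolding SO2_orbit_def
    by (intro CollectI exI[of _ "mat 1"] conjI rotation_matrix_group(1) rotate_tuple_mat_1[OF c', symmetric])
  ultimately show "\<exists>A. rotation_matrix A \<and> c' = rotate_tuple Fs A c"
    unfolding SO2_orbit_def by blast
next
  have sub: "SO2_orbit Fs (rotate_tuple Fs A x) \<subseteq> SO2_orbit Fs x" if "rotation_matrix A" for A x
    unfolding SO2_orbit_def rotate_tuple_compose using rotation_matrix_group(2)[OF _ that] by blast
  assume "\<exists>A. rotation_matrix A \<and> c' = rotate_tuple Fs A c"
  then obtain A where A: "rotation_matrix A" and c'A: "c' = rotate_tuple Fs A c" by blast
  have "rotate_tuple Fs (transpose A) c' = c"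
    unfolding c'A rotate_tuple_compose rotation_matrix_group(4)[OF A] by (rule rotate_tuple_mat_1[OF c])
  then have "SO2_orbit Fs c \<subseteq> SO2_orbit Fs c'"
    using sub[OF rotation_matrix_group(3)[OF A], of c'] by simp
  then show "SO2_orbit Fs c = SO2_orbit Fs c'"
    using sub[OF A, of c] unfolding c'A by blast
qed

section \<open>Attaching a linkage with two edges\<close>

definition two_bar :: "real^2 \<Rightarrow> real^2 \<Rightarrow> nat \<Rightarrow> real^2" where
  "two_bar y p = (\<lambda>i\<in>{..2}. if i = 0 then 0 else if i = 1 then y else p)"

lemma two_bar_vertices [simp]:
  "two_bar y p 0 = 0" "two_bar y p (Suc 0) = y" "two_bar y p 2 = p"
  by (simp_all add: two_bar_def)

lemma two_bar_configurations:
  "x \<in> configurations [a, b] \<and> x 0 = 0 \<longleftrightarrow>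
     (\<exists>y p. x = two_bar y p \<and> norm y = a \<and> norm (y - p) = b)"
proof
  assume x: "x \<in> configurations [a, b] \<and> x 0 = 0"
  then have "x i = two_bar (x 1) (x 2) i" for i
  proof -
    consider "i = 0" | "i = 1" | "i = 2" | "2 < i" by linarith
    then show ?thesis
      using x by cases (simp_all add: two_bar_def configurations_def extensional_def)
  qed
  then have "x = two_bar (x 1) (x 2)" by (rule ext)
  moreover have "norm (x 1) = a" "norm (x 1 - x 2) = b"
    using x by (auto simp: configurations_def less_Suc_eq all_conj_distrib numeral_2_eq_2)
  ultimately show "\<exists>y p. x = two_bar y p \<and> norm y = a \<and> norm (y - p) = b" by blast
next
  assume "\<exists>y p. x = two_bar y p \<and> norm y = a \<and> norm (y - p) = b"
  then show "x \<in> configurations [a, b] \<and> x 0 = 0"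
    by (auto simp: two_bar_def configurations_def less_Suc_eq numeral_2_eq_2)
qed

text \<open>
  The flag \<open>e\<close> selects the side of the line through \<open>0\<close> and the common terminal vertex.
\<close>

definition attach ::
    "real list list \<Rightarrow> real \<Rightarrow> real \<Rightarrow> bool \<Rightarrow> (nat \<Rightarrow> nat \<Rightarrow> real^2) \<Rightarrow> nat \<Rightarrow> nat \<Rightarrow> real^2" where
  "attach Fs a b e c =
     c(length Fs := two_bar (elbow a b e (endpoint Fs c)) (endpoint Fs c))"

text \<open>
  The signed area that tells on which side of the line through \<open>0\<close> and the common terminal vertex
  the middle vertex of the last linkage lies.
\<close>

definition bend :: "real list list \<Rightarrow> (nat \<Rightarrow> nat \<Rightarrow> real^2) \<Rightarrow> real" where
  "bend Fs d = d (length Fs) 1 \<bullet> quarter_turn (endpoint Fs d)"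

lemma restrict_attach:
  assumes "c \<in> topspace (C_space Fs)"
  shows "restrict (attach Fs a b e c) {..<length Fs} = c"
  using assms by (auto simp: attach_def topspace_C_space extensional_def restrict_def fun_eq_iff)

lemma endpoint_attach:
  assumes "Fs \<noteq> []"
  shows "endpoint Fs (attach Fs a b e c) = endpoint Fs c"
  using assms by (simp add: endpoint_def attach_def)

lemma endpoint_restrict:
  assumes "Fs \<noteq> []"
  shows "endpoint Fs (restrict d {..<length Fs}) = endpoint Fs d"
  using assms by (simp add: endpoint_def)

lemma attach_in_C_space:
  assumes "Fs \<noteq> []" "0 < a" "0 < b" and c: "c \<in> topspace (C_space Fs)"
    and p: "endpoint Fs c \<in> annulus a b"
  shows "attach Fs a b e c \<in> topspace (C_space (Fs @ [[a, b]]))"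
proof -
  let ?x = "two_bar (elbow a b e (endpoint Fs c)) (endpoint Fs c)"
  have "?x \<in> configurations [a, b] \<and> ?x 0 = 0"
    unfolding two_bar_configurations using norm_elbow[OF assms(2,3) p] by blast
  moreover have "attach Fs a b e c \<in> extensional {..length Fs}"
    using c by (auto simp: attach_def topspace_C_space extensional_def)
  moreover have "attach Fs a b e c (length Fs) = ?x"
    by (simp add: attach_def)
  ultimately show ?thesis
    using c restrict_attach[OF c, of a b e] endpoint_attach[OF assms(1), of a b e c]
    by (simp add: topspace_C_space_snoc[OF assms(1)] two_bar_def)
qed

lemma bend_attach:
  assumes "Fs \<noteq> []" "endpoint Fs c \<in> annulus a b"
  shows "0 < bend Fs (attach Fs a b e c) \<longleftrightarrow> e"
  using elbow_side(1)[OF assms(2)] endpoint_attach[OF assms(1)]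
  by (simp add: bend_def) (simp add: attach_def)

text \<open>
  By uniqueness of the elbow on a given side, an added two-edge configuration is recovered from
  the other configurations and the sign of its bend.
\<close>

lemma attach_restrict:
  assumes "Fs \<noteq> []" and d: "d \<in> topspace (C_space (Fs @ [[a, b]]))"
    and p: "endpoint Fs d \<in> annulus a b"
  shows "attach Fs a b (0 < bend Fs d) (restrict d {..<length Fs}) = d"
    and "bend Fs d \<noteq> 0"
proof -
  note d' = d[unfolded topspace_C_space_snoc[OF assms(1)]]
  then obtain y q where x: "d (length Fs) = two_bar y q" "norm y = a" "norm (y - q) = b"
    using two_bar_configurations[of "d (length Fs)" a b] by blast
  then have q: "q = endpoint Fs d"
    using d' by (simp add: two_bar_def x(1))
  have y: "y = elbow a b (0 < bend Fs d) (endpoint Fs d)"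
    using elbow_unique[OF p x(2)] x(3) by (simp add: q bend_def x(1))
  show "bend Fs d \<noteq> 0"
    using elbow_side(2)[OF p, of "0 < bend Fs d"] unfolding y[symmetric] by (simp add: bend_def x(1))
  show "attach Fs a b (0 < bend Fs d) (restrict d {..<length Fs}) = d"
    unfolding attach_def endpoint_restrict[OF assms(1)] y[symmetric]
    using d' x(1) by (auto simp: q fun_eq_iff extensional_def restrict_def)
qed

lemma rotate_attach:
  assumes "Fs \<noteq> []" "rotation_matrix A"
  shows "rotate_tuple (Fs @ [[a, b]]) A (attach Fs a b e c) = attach Fs a b e (rotate_tuple Fs A c)"
proof -
  have "endpoint Fs (rotate_tuple Fs A c) = A *v endpoint Fs c"
    using assms(1) by (simp add: endpoint_def rotate_tuple_def)
  then show ?thesis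
    using elbow_rotation[OF assms(2)]
    by (auto simp: attach_def rotate_tuple_def two_bar_def fun_eq_iff nth_append less_Suc_eq restrict_def)
qed

text \<open>
  The inverse forgets the last linkage and records on which side its elbow lies. It is continuous
  because the signed area is continuous and never zero, which makes each side an open condition.
\<close>

lemma homeomorphic_map_attach:
  assumes Fs: "Fs \<noteq> []" and ab: "0 < a" "0 < b"
    and annulus: "\<And>c. c \<in> topspace (C_space Fs) \<Longrightarrow> endpoint Fs c \<in> annulus a b"
  shows "homeomorphic_map (sum_topology (\<lambda>_. C_space Fs) UNIV) (C_space (Fs @ [[a, b]]))
           (\<lambda>(e, c). attach Fs a b e c)"
proof -
  let ?X = "C_space Fs" and ?Y = "C_space (Fs @ [[a, b]])" and ?n = "length Fs"
  let ?S = "sum_topology (\<lambda>_. ?X) (UNIV :: bool set)"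
  let ?g = "\<lambda>(e, c). attach Fs a b e c" and ?h = "\<lambda>d. (0 < bend Fs d, restrict d {..<?n})"
  have restrict: "restrict d {..<?n} \<in> topspace ?X" and annulus': "endpoint Fs d \<in> annulus a b"
    if "d \<in> topspace ?Y" for d
  proof -
    show "restrict d {..<?n} \<in> topspace ?X"
      using that topspace_C_space_snoc[OF Fs] by blast
    from annulus[OF this] show "endpoint Fs d \<in> annulus a b"
      by (simp only: endpoint_restrict[OF Fs])
  qed
  have attach: "continuous_map ?X ?Y (attach Fs a b e)" for e
  proof (rule continuous_map_into_C_space)
    show "attach Fs a b e c \<in> topspace ?Y" if "c \<in> topspace ?X" for c
      using attach_in_C_space[OF Fs ab that annulus[OF that]] .
    have p: "continuous_map ?X euclidean (endpoint Fs)"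
      unfolding endpoint_def using Fs by (intro continuous_map_vertex) auto
    then have "continuous_map ?X (top_of_set (annulus a b)) (endpoint Fs)"
      using annulus by (simp add: continuous_map_in_subtopology)
    from continuous_map_compose[OF this, of euclidean "elbow a b e"]
    have elbow: "continuous_map ?X euclidean (\<lambda>c. elbow a b e (endpoint Fs c))"
      by (simp add: o_def continuous_on_elbow)
    fix j i
    assume ji: "j < length (Fs @ [[a, b]])" "i \<le> length ((Fs @ [[a, b]]) ! j)"
    show "continuous_map ?X euclidean (\<lambda>c. attach Fs a b e c j i)"
    proof (cases "j < ?n")
      case True
      then show ?thesis
        using ji by (simp add: attach_def nth_append continuous_map_vertex)
    next
      case False
      then have "j = ?n" "i = 0 \<or> i = 1 \<or> i = 2"
        using ji by (auto simp: less_Suc_eq nth_append)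
      then show ?thesis
        using p elbow by (auto simp: attach_def)
    qed
  qed
  have "continuous_map ?S ?Y ?g"
    unfolding continuous_map_def
  proof (intro conjI allI impI)
    show "?g \<in> topspace ?S \<rightarrow> topspace ?Y"
      using attach_in_C_space[OF Fs ab] annulus by auto
    fix U assume U: "openin ?Y U"
    show "openin ?S {z \<in> topspace ?S. ?g z \<in> U}"
      using openin_continuous_map_preimage[OF attach U] by (auto simp: openin_sum_topology)
  qed
  moreover have "continuous_map ?Y ?S ?h"
    unfolding continuous_map_def
  proof (intro conjI allI impI)
    show "?h \<in> topspace ?Y \<rightarrow> topspace ?S"
      using restrict by auto
    fix U assume U: "openin ?S U"
    have r: "continuous_map ?Y ?X (\<lambda>d. restrict d {..<?n})"
    proof (rule continuous_map_into_C_space[OF restrict])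
      fix j i assume "j < length Fs" "i \<le> length (Fs ! j)"
      then show "continuous_map ?Y euclidean (\<lambda>d. restrict d {..<?n} j i)"
        using continuous_map_vertex[of j "Fs @ [[a, b]]" i] by (simp add: nth_append)
    qed
    have p: "continuous_map ?Y euclidean (endpoint Fs)"
      unfolding endpoint_def using Fs continuous_map_vertex[of 0 "Fs @ [[a, b]]"] by (simp add: nth_append)
    have "continuous_map ?Y euclidean (\<lambda>d. d ?n 1)"
      using continuous_map_vertex[of ?n "Fs @ [[a, b]]" 1] by (simp add: nth_append)
    from continuous_map_pairedI[OF this p] have pair: "continuous_map ?Y euclidean (\<lambda>d. (d ?n 1, endpoint Fs d))"
      by simp
    have "continuous_on UNIV (\<lambda>z :: (real^2) \<times> (real^2). fst z \<bullet> quarter_turn (snd z))"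
      by (intro continuous_intros continuous_on_compose2[OF continuous_on_quarter_turn[of UNIV]]) auto
    then have b: "continuous_map ?Y euclideanreal (bend Fs)"
      using continuous_map_compose[OF pair, of euclidean "\<lambda>z. fst z \<bullet> quarter_turn (snd z)"]
      unfolding bend_def by (simp add: o_def)
    \<comment> \<open>As \<open>bend\<close> has no zero, the side where it fails to be positive is the open side where
      it is negative.\<close>
    let ?P = "\<lambda>e. {d \<in> topspace ?Y. bend Fs d \<in> (if e then {0<..} else {..<0})} \<inter>
                  {d \<in> topspace ?Y. restrict d {..<?n} \<in> {c. (e, c) \<in> U}}"
    have "openin ?Y (?P e)" for e
      using U by (intro openin_Int openin_continuous_map_preimage[OF b] openin_continuous_map_preimage[OF r])
                 (auto simp: openin_sum_topology)
    then have "openin ?Y (?P True \<union> ?P False)"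
      by (intro openin_Un)
    moreover have "{d \<in> topspace ?Y. ?h d \<in> U} = ?P True \<union> ?P False"
    proof -
      have "?h d \<in> U \<longleftrightarrow> d \<in> ?P True \<union> ?P False" if "d \<in> topspace ?Y" for d
        using that attach_restrict(2)[OF Fs that annulus'[OF that]] by (cases "0 < bend Fs d") auto
      then show ?thesis by blast
    qed
    ultimately show "openin ?Y {d \<in> topspace ?Y. ?h d \<in> U}"
      by simp
  qed
  ultimately have "homeomorphic_maps ?S ?Y ?g ?h"
    unfolding homeomorphic_maps_def
  proof (intro conjI ballI)
    fix z assume "z \<in> topspace ?S"
    then obtain e c where "z = (e, c)" "c \<in> topspace ?X" by fastforce
    then show "?h (?g z) = z"
      using restrict_attach[of c] bend_attach[OF Fs annulus[of c]] by simp
  next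
    fix d assume "d \<in> topspace ?Y"
    then show "?g (?h d) = d"
      using attach_restrict(1)[OF Fs _ annulus'] by simp
  qed assumption+
  then show ?thesis
    by (simp add: homeomorphic_maps_map)
qed

text \<open>
  Both spaces are quotients of two disjoint copies of \<open>C_space Fs\<close>. What remains is that they have
  the same fibres: a rotation that takes one tuple with an elbow to another takes the remaining
  linkages to each other and keeps the elbow on its side.
\<close>

theorem M_space_attach_two_bar:
  assumes Fs: "Fs \<noteq> []" and ab: "0 < a" "0 < b"
    and annulus: "\<And>c. c \<in> topspace (C_space Fs) \<Longrightarrow> endpoint Fs c \<in> annulus a b"
  shows "M_space (Fs @ [[a, b]]) homeomorphic_space
           sum_topology (\<lambda>_. M_space Fs) (UNIV :: bool set)"
proof (rule quotient_maps_same_fibres_homeomorphic_space)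
  let ?S = "sum_topology (\<lambda>_. C_space Fs) (UNIV :: bool set)"
  show "quotient_map ?S (M_space (Fs @ [[a, b]]))
          (SO2_orbit (Fs @ [[a, b]]) \<circ> (\<lambda>(e, c). attach Fs a b e c))"
    unfolding M_space_def
    using homeomorphic_map_attach[OF assms] quotient_map_quotient_topology
    unfolding homeomorphic_map_def by (blast intro: quotient_map_compose)
  show "quotient_map ?S (sum_topology (\<lambda>_. M_space Fs) UNIV) (\<lambda>(e, c). (e, SO2_orbit Fs c))"
    unfolding M_space_def by (intro quotient_map_sum_topology quotient_map_quotient_topology)
  fix z z' assume z: "z \<in> topspace ?S" "z' \<in> topspace ?S"
  obtain e c e' c' where zz: "z = (e, c)" "z' = (e', c')" by fastforce
  with z have c: "c \<in> topspace (C_space Fs)" and c': "c' \<in> topspace (C_space Fs)" by auto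
  have "attach Fs a b e' c' = attach Fs a b e (rotate_tuple Fs A c) \<longleftrightarrow>
        e = e' \<and> c' = rotate_tuple Fs A c" (is "?L \<longleftrightarrow> _") for A
  proof
    assume ?L
    moreover have "restrict (attach Fs a b e (rotate_tuple Fs A c)) {..<length Fs} = rotate_tuple Fs A c"
      by (auto simp: attach_def rotate_tuple_def restrict_def fun_eq_iff)
    ultimately have "c' = rotate_tuple Fs A c"
      using restrict_attach[OF c'] by metis
    moreover from this have "e = e'"
      using \<open>?L\<close> bend_attach[OF Fs annulus[OF c']] by metis
    ultimately show "e = e' \<and> c' = rotate_tuple Fs A c" by blast
  qed auto
  moreover have "SO2_orbit (Fs @ [[a, b]]) (attach Fs a b e c) = SO2_orbit (Fs @ [[a, b]]) (attach Fs a b e' c')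
      \<longleftrightarrow> (\<exists>A. rotation_matrix A \<and> attach Fs a b e' c' = attach Fs a b e (rotate_tuple Fs A c))"
    using SO2_orbit_eq_iff[OF attach_in_C_space[OF Fs ab c annulus[OF c]] attach_in_C_space[OF Fs ab c' annulus[OF c']]]
      rotate_attach[OF Fs] by metis
  ultimately show "(SO2_orbit (Fs @ [[a, b]]) \<circ> (\<lambda>(e, c). attach Fs a b e c)) z =
         (SO2_orbit (Fs @ [[a, b]]) \<circ> (\<lambda>(e, c). attach Fs a b e c)) z' \<longleftrightarrow>
       (\<lambda>(e, c). (e, SO2_orbit Fs c)) z = (\<lambda>(e, c). (e, SO2_orbit Fs c)) z'"
    using SO2_orbit_eq_iff[OF c c'] by (auto simp: zz)
qed

section \<open>Length ranges\<close>

lemma norm_configuration_le_sum_list: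
  assumes x: "x \<in> configurations ds" 
  shows "norm (x (length ds) - x 0) \<le> sum_list ds"
proof -
  have "norm (x k - x 0) \<le> sum_list (take k ds)" if "k \<le> length ds" for k
    using that
  proof (induction k)
    case (Suc k)
    have "norm (x (Suc k) - x 0) \<le> norm (x (Suc k) - x k) + norm (x k - x 0)"
      by (metis norm_triangle_ineq diff_add_cancel add_diff_eq)
    also have "norm (x (Suc k) - x k) = ds ! k"
      using x Suc.prems by (simp add: configurations_def norm_minus_commute)
    finally show ?case
      using Suc by (simp add: take_Suc_conv_app_nth)
  qed simp
  from this[of "length ds"] show ?thesis by simp
qed

text \<open>
  A single linkage in the tuple already confines the common terminal vertex to its own length range.
\<close>

lemma norm_endpoint_in_length_range:
  assumes c: "c \<in> topspace (C_space Fs)" and j: "j < length Fs"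
    and range: "has_length_range (Fs ! j) l1 l2"
  shows "l1 \<le> norm (endpoint Fs c)" "norm (endpoint Fs c) \<le> l2"
proof -
  have "c j \<in> configurations (Fs ! j)" "c j (length (Fs ! j)) - c j 0 = endpoint Fs c"
    using c j by (auto simp: topspace_C_space)
  then show "l1 \<le> norm (endpoint Fs c)" "norm (endpoint Fs c) \<le> l2"
    using range norm_configuration_le_sum_list[of "c j" "Fs ! j"]
    by (auto simp: has_length_range_def)
qed

text \<open>
  The distance of the common terminal vertex from the origin lies in both length ranges, hence
  between the larger of the two lower ends and the smaller of the two upper ends.
\<close>

theorem proposition5p9:
  fixes F1 F2 :: "real list" and l11 l12 l21 l22 a b :: real
  assumes "free_linkage F1" and "free_linkage F2" and "free_linkage [a, b]"
    and "has_length_range F1 l11 l12" and "has_length_range F2 l21 l22"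
    and "\<bar>a - b\<bar> < max l11 l21" and "a + b > min l12 l22"
  shows "M_space [F1, F2, [a, b]] homeomorphic_space
           sum_topology (\<lambda>_. M_space [F1, F2]) (UNIV :: bool set)"
proof -
  have "endpoint [F1, F2] c \<in> annulus a b" if c: "c \<in> topspace (C_space [F1, F2])" for c
    using norm_endpoint_in_length_range[OF c, of 0 l11 l12]
      norm_endpoint_in_length_range[OF c, of 1 l21 l22] assms(4-7)
    by (auto simp: annulus_def less_max_iff_disj min_less_iff_disj)
  moreover have "0 < a" "0 < b"
    using assms(3) by (simp_all add: free_linkage_def)
  ultimately have "M_space ([F1, F2] @ [[a, b]]) homeomorphic_space
      sum_topology (\<lambda>_. M_space [F1, F2]) (UNIV :: bool set)"
    by (intro M_space_attach_two_bar) auto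
  then show ?thesis by simp
qed

end
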